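(* For all positive integers $k$ and $N$, there exists a $(4k-2)$-regular graph $G$ such that for every partition of $V(G)$ into $k$ sets $X_1,X_2,\ldots,X_k$, there exists $i$ with $1\le i\le k$ such that some connected component of $G[X_i]$ contains at least $N$ vertices.
   Context: All graphs are finite and simple; $G[X]$ denotes the subgraph of $G$ induced on $X$. *)

theory Defs
  imports "Graph_Theory.Graph_Theory" "HOL-Library.Disjoint_Sets"
begin

text \<open>
  Finite simple graphs are the library's \<^locale>\<open>graph\<close>: finite, loop-free, symmetric digraphs
  without parallel arcs. An undirected edge is a pair of opposite arcs, so the degree of a vertex,
  that is its number of neighbours, is its out-degree.
\<close>

definition regular_graph :: "nat \<Rightarrow> ('a, 'b) pre_digraph \<Rightarrow> bool" where
  "regular_graph d G \<longleftrightarrow> graph G \<and> (\<forall>v \<in> verts G. out_degree G v = d)"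

definition graph_component :: "('a, 'b) pre_digraph \<Rightarrow> ('a, 'b) pre_digraph \<Rightarrow> bool" where
  "graph_component G C \<longleftrightarrow> pre_digraph.max_subgraph G connected C"

text \<open>Parts may be empty.\<close>

definition indexed_partition :: "nat \<Rightarrow> (nat \<Rightarrow> 'a set) \<Rightarrow> 'a set \<Rightarrow> bool" where
  "indexed_partition k X V \<longleftrightarrow> (\<Union>i\<in>{1..k}. X i) = V \<and> disjoint_family_on X {1..k}"

end

theory Submission
  imports Defs "HOL-Combinatorics.Permutations"
begin

text \<open>
  Take a finite \<open>2k\<close>-regular graph \<open>H\<close> without cycles of length at most \<open>N\<close>, and let \<open>G\<close> be its line
  graph, which is \<open>(4k-2)\<close>-regular. Since \<open>H\<close> has \<open>k |V(H)|\<close> edges, one of the \<open>k\<close> classes contains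
  at least \<open>|V(H)|\<close> edges, so it contains a subgraph of minimum degree two. A non-backtracking walk
  in that subgraph visits \<open>N + 1\<close> distinct vertices, and its edges are \<open>N\<close> vertices of one component.

  For \<open>H\<close> we take a Cayley graph of the symmetric group on the vertices of a truncated \<open>d\<close>-regular
  tree with \<open>d = 2k\<close>, whose edges are properly coloured by \<open>d\<close> colours: each colour gives the
  involution that swaps the ends of all edges of that colour, and a reduced word in these
  involutions moves the root away along a path of the tree.
\<close>

section \<open>Regular graphs of large girth\<close>

text \<open>A vertex of the tree is the sequence of colours on the path to the root \<open>[]\<close>, last colour first.\<close>

definition tree_words :: "nat \<Rightarrow> nat \<Rightarrow> nat list set" where
  "tree_words d r = {w. set w \<subseteq> {..<d} \<and> length w \<le> r \<and> distinct_adj w}"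

text \<open>A word of length \<open>r\<close> not headed by \<open>c\<close> is fixed because
  truncation cut off its edge of colour \<open>c\<close>. Lists outside the tree are fixed because
  \<open>permutes\<close> demands it.\<close>

definition colour_swap :: "nat \<Rightarrow> nat \<Rightarrow> nat \<Rightarrow> nat list \<Rightarrow> nat list" where
  "colour_swap d r c w =
     (if w \<notin> tree_words d r then w
      else if w \<noteq> [] \<and> hd w = c then tl w
      else if length w < r then c # w else w)"

lemma finite_tree_words: "finite (tree_words d r)"
  by (rule finite_subset[OF _ finite_lists_length_le[of "{..<d}" r]]) (auto simp: tree_words_def)

lemma Nil_in_tree_words [simp]: "[] \<in> tree_words d r"
  by (simp add: tree_words_def)

lemma colour_swap_in_tree_words:
  assumes "c < d" "w \<in> tree_words d r"
  shows "colour_swap d r c w \<in> tree_words d r"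
  using assms by (cases w) (auto simp: colour_swap_def tree_words_def distinct_adj_Cons)

lemma colour_swap_colour_swap:
  assumes "c < d"
  shows "colour_swap d r c (colour_swap d r c w) = w"
proof (cases "w \<in> tree_words d r")
  case True
  then show ?thesis
    using colour_swap_in_tree_words[OF assms True]
    by (cases w) (auto simp: colour_swap_def tree_words_def distinct_adj_Cons)
qed (simp add: colour_swap_def)

lemma colour_swap_permutes:
  assumes "c < d"
  shows "colour_swap d r c permutes tree_words d r"
proof (rule bij_imp_permutes)
  show "bij_betw (colour_swap d r c) (tree_words d r) (tree_words d r)"
    by (rule bij_betw_byWitness[where f' = "colour_swap d r c"])
       (use assms in \<open>auto simp: colour_swap_colour_swap colour_swap_in_tree_words\<close>)
qed (simp add: colour_swap_def)

text \<open>Consecutive colours differ, so the next colour is never the head of the current word;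
  below depth \<open>r\<close> every swap therefore pushes its colour and none pops. The walk of
  permutations is followed through the image of one point \<open>a\<close>.\<close>

lemma colour_swap_walk:
  assumes walk: "\<And>i. c i < d \<and> x (Suc i) = colour_swap d r (c i) \<circ> x i"
    and reduced: "\<And>i. c (Suc i) \<noteq> c i"
    and "x 0 a = []" "n \<le> r"
  shows "x n a = rev (map c [0..<n]) \<and> rev (map c [0..<n]) \<in> tree_words d r"
  using \<open>n \<le> r\<close>
proof (induction n)
  case 0
  then show ?case using assms by simp
next
  case (Suc n)
  let ?w = "rev (map c [0..<n])"
  have IH: "x n a = ?w" "?w \<in> tree_words d r" using Suc by auto
  have hd: "?w = [] \<or> c n \<noteq> hd ?w"
    using reduced by (cases n) auto
  have "colour_swap d r (c n) ?w = c n # ?w"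
    using IH hd Suc.prems by (auto simp: colour_swap_def)
  moreover have "c n # ?w \<in> tree_words d r"
    using IH hd Suc.prems walk[of n] by (auto simp: tree_words_def distinct_adj_Cons)
  ultimately show ?case using IH walk[of n] by simp
qed

text \<open>The last conjunct encodes girth above \<open>N\<close>: running around a cycle of length
  at most \<open>N\<close> forever would be a non-backtracking walk that repeats a vertex within its
  first \<open>N + 1\<close>.\<close>

lemma large_girth_regular_graph_exists:
  fixes d N :: nat
  shows "\<exists>(V :: (nat list \<Rightarrow> nat list) set) adj. finite V \<and> V \<noteq> {} \<and>
     (\<forall>u v. adj u v \<longrightarrow> u \<in> V \<and> v \<in> V) \<and> symp adj \<and> irreflp adj \<and>
     (\<forall>v\<in>V. card {u. adj v u} = d) \<and>
     (\<forall>x. (\<forall>i. adj (x i) (x (Suc i)) \<and> x (Suc (Suc i)) \<noteq> x i) \<longrightarrow> inj_on x {..N})"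
proof -
  \<comment> \<open>Depth \<open>N\<close> suffices for walks of \<open>N\<close> steps; the extra
    level keeps \<open>r\<close> positive even for \<open>N = 0\<close>, so that every colour moves
    the root.\<close>
  define r where "r = Suc N"
  define V where "V = {p. p permutes tree_words d r}"
  define adj where "adj p q \<longleftrightarrow> p \<in> V \<and> (\<exists>c<d. q = colour_swap d r c \<circ> p)" for p q
  have move: "colour_swap d r c [] = [c]" for c
    by (simp add: colour_swap_def r_def)
  have root: "\<exists>a. p a = []" if "p \<in> V" for p
    using that permutes_surj unfolding V_def by (metis mem_Collect_eq surjD)
  have inV: "colour_swap d r c \<circ> p \<in> V" if "c < d" "p \<in> V" for c p
    using that by (auto simp: V_def intro: permutes_compose colour_swap_permutes)
  \<comment> \<open>At a point that \<open>p\<close> sends to the root, the two sides take the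
    values \<open>[c]\<close> and \<open>[c']\<close>.\<close>
  have colour_unique: "c = c'" if "p \<in> V" "colour_swap d r c \<circ> p = colour_swap d r c' \<circ> p" for p c c'
    using root[OF that(1)] that(2) move by (metis comp_apply list.inject)
  have swap_back: "colour_swap d r c \<circ> (colour_swap d r c \<circ> p) = p" if "c < d" for c p
    using that by (auto simp: fun_eq_iff colour_swap_colour_swap)
  have "finite V"
    unfolding V_def by (rule finite_permutations[OF finite_tree_words])
  moreover have "V \<noteq> {}"
    unfolding V_def using permutes_id by blast
  moreover have adjV: "\<forall>u v. adj u v \<longrightarrow> u \<in> V \<and> v \<in> V"
    by (auto simp: adj_def inV)
  moreover have "symp adj"
  proof (rule sympI)
    fix p q assume "adj p q"
    then show "adj q p" using inV swap_back unfolding adj_def by metis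
  qed
  moreover have "irreflp adj"
  proof (rule irreflpI)
    fix p show "\<not> adj p p"
      using root[of p] move unfolding adj_def by (metis comp_apply list.distinct(1))
  qed
  moreover have "card {u. adj v u} = d" if "v \<in> V" for v
  proof -
    have "{u. adj v u} = (\<lambda>c. colour_swap d r c \<circ> v) ` {..<d}"
      using that by (auto simp: adj_def)
    moreover have "inj_on (\<lambda>c. colour_swap d r c \<circ> v) {..<d}"
      using colour_unique[OF that] by (auto intro: inj_onI)
    ultimately show ?thesis by (simp add: card_image)
  qed
  moreover have "inj_on x {..N}"
    if x: "\<And>i. adj (x i) (x (Suc i)) \<and> x (Suc (Suc i)) \<noteq> x i" for x
  proof -
    have "\<forall>i. \<exists>c. c < d \<and> x (Suc i) = colour_swap d r c \<circ> x i"
      using x unfolding adj_def by blast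
    then obtain c where c: "\<And>i. c i < d \<and> x (Suc i) = colour_swap d r (c i) \<circ> x i"
      by metis
    \<comment> \<open>Using the same involution twice in a row would return to
      \<open>x i\<close>.\<close>
    have red: "c (Suc i) \<noteq> c i" for i
      using x[of i] c[of i] c[of "Suc i"] swap_back by metis
    have "x i \<noteq> x j" if "i < j" "j \<le> N" for i j
    proof -
      \<comment> \<open>Start the walk at time \<open>i\<close> and follow the point that
        \<open>x i\<close> sends to the root: at time \<open>j\<close> its image is a word of length
        \<open>j - i > 0\<close>, hence not the root.\<close>
      have "x i \<in> V" using x adjV by blast
      then obtain a where a: "x i a = []" using root by blast
      let ?x = "\<lambda>m. x (i + m)" and ?c = "\<lambda>m. c (i + m)"
      have "?x (j - i) a = rev (map ?c [0..<j - i])"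
        using colour_swap_walk[of ?c d ?x r a "j - i"] c red a that by (simp add: r_def)
      then have "x j a \<noteq> []" using that by auto
      then show ?thesis using a by auto
    qed
    then show ?thesis by (intro linorder_inj_onI) auto
  qed
  ultimately show ?thesis by blast
qed

section \<open>Subgraphs of minimum degree two\<close>

text \<open>The degree-sum hypothesis says that there are at least as many edges as vertices.
  Deleting a vertex of degree at most one lowers the degree sum by at most two and twice the vertex
  count by exactly two, so the hypothesis survives. The deletion cannot leave the empty set, since a
  lone vertex has degree sum 0.\<close>

lemma min_degree_two_subset:
  assumes "finite V" "V \<noteq> {}" "symp R" "irreflp R"
    and "2 * card V \<le> (\<Sum>v\<in>V. card {u\<in>V. R v u})"
  shows "\<exists>W\<subseteq>V. W \<noteq> {} \<and> (\<forall>v\<in>W. 2 \<le> card {u\<in>W. R v u})"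
  using assms(1,2,5)
proof (induction V rule: finite_psubset_induct)
  case (psubset V)
  show ?case
  proof (cases "\<forall>v\<in>V. 2 \<le> card {u\<in>V. R v u}")
    case True
    then show ?thesis using psubset by blast
  next
    case False
    then obtain v where v: "v \<in> V" "card {u\<in>V. R v u} \<le> 1" by force
    let ?W = "V - {v}"
    have irr: "\<not> R v v" using \<open>irreflp R\<close> by (simp add: irreflpD)
    have nbr: "card {u\<in>V. R x u} = card {u\<in>?W. R x u} + (if R v x then 1 else 0)"
      if "x \<in> ?W" for x
    proof (cases "R v x")
      case True
      then have "R x v" using \<open>symp R\<close> by (simp add: sympD)
      then have "{u\<in>V. R x u} = insert v {u\<in>?W. R x u}" using v by auto
      then show ?thesis using True psubset.hyps by simp
    next
      case False
      then have "\<not> R x v" using \<open>symp R\<close> by (meson sympD)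
      then have "{u\<in>V. R x u} = {u\<in>?W. R x u}" by auto
      then show ?thesis using False by simp
    qed
    \<comment> \<open>The degree of \<open>v\<close> is lost twice: as its own summand, and as one
      unit at each of its neighbours.\<close>
    have "(\<Sum>x\<in>?W. if R v x then 1 else 0) = card (?W \<inter> {u. R v u})"
      using psubset.hyps by (simp add: sum.If_cases)
    also have "?W \<inter> {u. R v u} = {u\<in>V. R v u}" using irr by auto
    finally have "(\<Sum>x\<in>V. card {u\<in>V. R x u})
        = 2 * card {u\<in>V. R v u} + (\<Sum>x\<in>?W. card {u\<in>?W. R x u})"
      using v nbr psubset.hyps by (simp add: sum.remove[OF _ v(1)] sum.distrib)
    moreover have "card V = Suc (card ?W)"
      using v psubset.hyps by (metis card.remove)
    ultimately have le: "2 * card ?W \<le> (\<Sum>x\<in>?W. card {u\<in>?W. R x u})"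
      using psubset.prems v by linarith
    have "?W \<noteq> {}"
    proof
      assume "?W = {}"
      then have "V = {v}" using v by auto
      then have "\<forall>x\<in>V. card {u\<in>V. R x u} = 0" using irr by auto
      then have "(\<Sum>x\<in>V. card {u\<in>V. R x u}) = 0" by (rule sum.neutral)
      then have "card V = 0" using psubset.prems(2) by linarith
      then show False using psubset.prems(1) psubset.hyps by simp
    qed
    then show ?thesis using psubset.IH[of ?W] le v by blast
  qed
qed

lemma non_backtracking_walk_exists:
  assumes "W \<noteq> {}" and deg: "\<And>v. v \<in> W \<Longrightarrow> 2 \<le> card {u\<in>W. R v u}"
  shows "\<exists>x :: nat \<Rightarrow> 'a. \<forall>i. R (x i) (x (Suc i)) \<and> x (Suc (Suc i)) \<noteq> x i"
proof -
  have other: "\<exists>u\<in>W. R v u \<and> u \<noteq> w" if "v \<in> W" for v w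
  proof (rule ccontr)
    assume "\<not> ?thesis"
    then have "{u\<in>W. R v u} \<subseteq> {w}" by auto
    then have "card {u\<in>W. R v u} \<le> 1"
      using card_mono[of "{w}"] by simp
    then show False using deg[OF that] by simp
  qed
  \<comment> \<open>The state is the pair of previous and current vertex, which turns
    non-backtracking into a condition on successive states, as dependent choice requires.\<close>
  have "\<exists>f. \<forall>n::nat. (snd (f n) \<in> W \<and> R (fst (f n)) (snd (f n))) \<and>
      (fst (f (Suc n)) = snd (f n) \<and> snd (f (Suc n)) \<noteq> fst (f n))"
  proof (rule dependent_nat_choice)
    show "\<exists>p. snd p \<in> W \<and> R (fst p) (snd p)"
      using \<open>W \<noteq> {}\<close> other by fastforce
  next
    fix p and n :: nat
    assume "snd p \<in> W \<and> R (fst p) (snd p)"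
    then show "\<exists>q. (snd q \<in> W \<and> R (fst q) (snd q)) \<and> (fst q = snd p \<and> snd q \<noteq> fst p)"
      using other[of "snd p" "fst p"] by fastforce
  qed
  then obtain f where "\<And>n::nat. (snd (f n) \<in> W \<and> R (fst (f n)) (snd (f n))) \<and>
      (fst (f (Suc n)) = snd (f n) \<and> snd (f (Suc n)) \<noteq> fst (f n))" by blast
  then show ?thesis by (intro exI[of _ "fst \<circ> f"]) simp
qed

section \<open>Line graphs\<close>

text \<open>This is the degree of an edge in the line graph: \<open>d - 1\<close> further edges at
  each end, and no edge is counted twice because only \<open>{a, b}\<close> contains both
  ends.\<close>

lemma card_adjacent_edges:
  assumes "symp adj" "irreflp adj" "finite {u. adj a u}" "finite {u. adj b u}"
    and deg: "card {u. adj a u} = d" "card {u. adj b u} = d"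
    and "adj a b"
  shows "card {e. (\<exists>u v. e = {u, v} \<and> adj u v) \<and> e \<noteq> {a, b} \<and> e \<inter> {a, b} \<noteq> {}} = 2 * (d - 1)"
proof -
  let ?A = "(\<lambda>u. {a, u}) ` ({u. adj a u} - {b})"
  let ?B = "(\<lambda>u. {b, u}) ` ({u. adj b u} - {a})"
  have sym: "adj u v \<Longrightarrow> adj v u" for u v using \<open>symp adj\<close> by (simp add: sympD)
  have irr: "\<not> adj u u" for u using \<open>irreflp adj\<close> by (simp add: irreflpD)
  have "a \<noteq> b" using irr \<open>adj a b\<close> by auto
  have "{e. (\<exists>u v. e = {u, v} \<and> adj u v) \<and> e \<noteq> {a, b} \<and> e \<inter> {a, b} \<noteq> {}} = ?A \<union> ?B" (is "?L = _")
  proof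
    show "?L \<subseteq> ?A \<union> ?B"
    proof
      fix e assume "e \<in> ?L"
      then obtain u v where e: "e = {u, v}" "adj u v" "e \<noteq> {a, b}" "e \<inter> {a, b} \<noteq> {}" by blast
      then consider "u = a" | "u = b" | "v = a" | "v = b" by auto
      then show "e \<in> ?A \<union> ?B"
        using e sym[of u v] by cases (auto simp: insert_commute)
    qed
    show "?A \<union> ?B \<subseteq> ?L"
      using irr by (auto simp: doubleton_eq_iff)
  qed
  moreover have "?A \<inter> ?B = {}"
    using \<open>a \<noteq> b\<close> by (auto simp: doubleton_eq_iff)
  moreover have "card ?A = d - 1" "card ?B = d - 1"
    using deg \<open>adj a b\<close> sym assms(3,4)
    by (subst card_image; auto simp: inj_on_def doubleton_eq_iff)+
  moreover have "finite ?A" "finite ?B" using assms(3,4) by auto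
  ultimately show ?thesis by (simp add: card_Un_disjoint)
qed

text \<open>When \<open>h\<close> numbers the edges of a graph injectively, this is its line graph,
  with natural numbers as vertices. Taking an arc to be the pair of its ends rules out parallel
  arcs.\<close>

definition intersection_graph :: "nat set \<Rightarrow> (nat \<Rightarrow> 'a set) \<Rightarrow> (nat, nat \<times> nat) pre_digraph" where
  "intersection_graph I h =
     \<lparr>verts = I, arcs = {(i, j). i \<in> I \<and> j \<in> I \<and> i \<noteq> j \<and> h i \<inter> h j \<noteq> {}}, tail = fst, head = snd\<rparr>"

lemma verts_intersection_graph [simp]: "verts (intersection_graph I h) = I"
  by (simp add: intersection_graph_def)

lemma graph_intersection_graph:
  assumes "finite I"
  shows "graph (intersection_graph I h)"
proof -
  have "finite {(i, j). i \<in> I \<and> j \<in> I \<and> i \<noteq> j \<and> h i \<inter> h j \<noteq> {}}"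
    by (rule finite_subset[of _ "I \<times> I"]) (use assms in auto)
  then show ?thesis
    using assms
    by unfold_locales (auto simp: intersection_graph_def symmetric_conv arc_to_ends_def)
qed

lemma out_degree_intersection_graph:
  assumes "i \<in> I" "inj_on h I"
  shows "out_degree (intersection_graph I h) i = card {e \<in> h ` I. e \<noteq> h i \<and> e \<inter> h i \<noteq> {}}"
proof -
  let ?J = "{j\<in>I. i \<noteq> j \<and> h i \<inter> h j \<noteq> {}}"
  have "out_arcs (intersection_graph I h) i = Pair i ` ?J"
    using assms by (force simp: out_arcs_def intersection_graph_def)
  then have "out_degree (intersection_graph I h) i = card ?J"
    by (simp add: out_degree_def card_image inj_on_def)
  also have "\<dots> = card (h ` ?J)"
    by (rule card_image[symmetric]) (use assms in \<open>auto simp: inj_on_def\<close>)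
  also have "h ` ?J = {e \<in> h ` I. e \<noteq> h i \<and> e \<inter> h i \<noteq> {}}"
    using assms by (auto simp: inj_on_def)
  finally show ?thesis .
qed

lemma dominates_induced_intersection_graph:
  assumes "i \<in> S" "j \<in> S" "S \<subseteq> I" "i \<noteq> j" "h i \<inter> h j \<noteq> {}"
  shows "i \<rightarrow>\<^bsub>intersection_graph I h \<restriction> S\<^esub> j"
  unfolding arcs_ends_conv
  by (rule image_eqI[of _ _ "(i, j)"]) (use assms in \<open>auto simp: intersection_graph_def\<close>)

section \<open>Components as reachability classes\<close>

lemma (in sym_digraph) graph_component_of_reachable:
  assumes "u \<in> verts G"
  shows "graph_component G (G \<restriction> {v. u \<rightarrow>\<^sup>* v})"
proof -
  let ?C = "G \<restriction> {v. u \<rightarrow>\<^sup>* v}"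
  \<comment> \<open>This is maximality among strongly connected subgraphs; it remains to pass to
    \<open>connected\<close>, which is strong connectedness of the symmetric closure.\<close>
  have C: "max_subgraph strongly_connected ?C"
    using induce_reachable_is_in_sccs[OF assms] sccs_altdef2 by blast
  have ind: "induced_subgraph ?C G"
    using induced_subgraphI_arc_mono[OF C] by simp
  interpret C: wf_digraph ?C by (rule wellformed_induce_subgraph)
  have symC: "symmetric ?C" using induced_graph_imp_symmetric[OF sym_arcs ind] .
  have "connected ?C"
    using max_subgraph_prop[OF C] symC
    by (auto simp: connected_def strongly_connected_def C.reachable_mk_symmetric_eq)
  \<comment> \<open>By symmetry of \<open>G\<close>, all vertices of a connected \<open>H\<close>
    containing \<open>u\<close> are reachable from \<open>u\<close>. So \<open>H\<close> has the
    vertices of \<open>?C\<close>, and since \<open>?C\<close> is induced it contains all arcs of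
    \<open>H\<close>.\<close>
  moreover have "\<not> connected H" if H: "?C \<noteq> H" "subgraph ?C H" "subgraph H G" for H
  proof
    assume conn: "connected H"
    have "u \<in> verts H" using H(2) assms by (auto simp: subgraph_def)
    have "verts H \<subseteq> {v. u \<rightarrow>\<^sup>* v}"
    proof
      fix v assume "v \<in> verts H"
      then have "u \<rightarrow>\<^sup>*\<^bsub>mk_symmetric H\<^esub> v"
        using conn \<open>u \<in> verts H\<close> by (auto simp: connected_def strongly_connected_def)
      then have "u \<rightarrow>\<^sup>*\<^bsub>mk_symmetric G\<^esub> v"
        using subgraph_mk_symmetric[OF H(3)] by (rule pre_digraph.reachable_mono)
      then show "v \<in> {v. u \<rightarrow>\<^sup>* v}" by (simp add: reachable_mk_symmetric_eq[OF sym_arcs])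
    qed
    moreover have "{v. u \<rightarrow>\<^sup>* v} \<subseteq> verts H" using H(2) by (simp add: subgraph_def)
    ultimately have V: "verts H = verts ?C" by simp
    interpret H: wf_digraph H using H(3) by (simp add: subgraph_def)
    have "subgraph H ?C"
      using subgraph_induce_subgraphI2[OF H(3)] V by simp
    then show False using H(1,2) by (auto simp: subgraph_def compatible_def)
  qed
  ultimately show ?thesis
    unfolding graph_component_def
    using ind by (intro max_subgraphI) (auto simp: induced_subgraph_def)
qed

section \<open>Partitions of the line graph as edge colourings\<close>

theorem theorem4p3:
  fixes k N :: nat
  assumes "k \<ge> 1" and "N \<ge> 1"
  shows "\<exists>G :: (nat, nat \<times> nat) pre_digraph.
           regular_graph (4 * k - 2) G \<and>
           (\<forall>X. indexed_partition k X (verts G) \<longrightarrow>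
              (\<exists>i\<in>{1..k}. \<exists>C. graph_component (G \<restriction> X i) C \<and> card (verts C) \<ge> N))"
proof -
  obtain V :: "(nat list \<Rightarrow> nat list) set" and adj where
    V: "finite V" "V \<noteq> {}" "\<And>u v. adj u v \<Longrightarrow> u \<in> V \<and> v \<in> V" and
    adj: "symp adj" "irreflp adj" and
    deg: "\<And>v. v \<in> V \<Longrightarrow> card {u. adj v u} = 2 * k" and
    girth: "\<And>x. (\<And>i. adj (x i) (x (Suc i)) \<and> x (Suc (Suc i)) \<noteq> x i) \<Longrightarrow> inj_on x {..N}"
    using large_girth_regular_graph_exists[of "2 * k" N] by blast
  define E where "E = {e. \<exists>u v. e = {u, v} \<and> adj u v}"
  have fin_nbrs: "finite {u. adj v u}" for v
    using V by (auto intro: finite_subset[OF _ \<open>finite V\<close>])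
  have E_iff: "{u, v} \<in> E \<longleftrightarrow> adj u v" for u v
    using adj(1) by (auto simp: E_def doubleton_eq_iff dest: sympD)
  have "E \<subseteq> Pow V" using V(3) by (auto simp: E_def)
  then have "finite E" using V(1) finite_subset by blast
  then obtain h where h: "bij_betw h {0..<card E} E"
    using ex_bij_betw_nat_finite by blast
  define I where "I = {0..<card E}"
  have h: "inj_on h I" "h ` I = E" "finite I"
    using h by (auto simp: bij_betw_def I_def)
  define G where "G = intersection_graph I h"
  interpret G: graph G unfolding G_def using graph_intersection_graph h by blast

  have "regular_graph (4 * k - 2) G"
    unfolding regular_graph_def
  proof (intro conjI ballI)
    show "graph G" by (rule G.graph_axioms)
    fix i assume "i \<in> verts G"
    then have i: "i \<in> I" by (simp add: G_def)
    then have "h i \<in> E" using h(2) by blast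
    then obtain a b where ab: "h i = {a, b}" "adj a b" unfolding E_def by blast
    have "out_degree G i = card {e \<in> E. e \<noteq> {a, b} \<and> e \<inter> {a, b} \<noteq> {}}"
      using out_degree_intersection_graph[OF i h(1)] h(2) ab by (simp add: G_def)
    also have "\<dots> = 2 * (2 * k - 1)"
      using card_adjacent_edges[of adj a b "2 * k"] adj fin_nbrs deg V(3)[OF ab(2)] ab(2)
      by (simp add: E_def)
    finally show "out_degree G i = 4 * k - 2" by simp
  qed

  moreover have "\<exists>i\<in>{1..k}. \<exists>C. graph_component (G \<restriction> X i) C \<and> card (verts C) \<ge> N"
    if X: "indexed_partition k X (verts G)" for X
  proof -
    \<comment> \<open>\<open>R i\<close> is the subgraph of the large-girth graph formed by the
      edges whose numbers lie in \<open>X i\<close>.\<close>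
    define R where "R i v u \<longleftrightarrow> {v, u} \<in> h ` X i" for i v u
    have XI: "(\<Union>i\<in>{1..k}. X i) = I" "disjoint_family_on X {1..k}"
      using X by (auto simp: indexed_partition_def G_def)
    \<comment> \<open>Averaging: \<open>h\<close> is injective, so each edge lies in one class and
      the degrees of a vertex in the \<open>k\<close> classes add up to \<open>2 * k\<close>. The
      total is \<open>2 * k * card V\<close>, so not every class falls below
      \<open>2 * card V\<close>.\<close>
    have "\<exists>i\<in>{1..k}. 2 * card V \<le> (\<Sum>v\<in>V. card {u\<in>V. R i v u})"
    proof (rule ccontr)
      assume "\<not> ?thesis"
      then have "(\<Sum>i\<in>{1..k}. \<Sum>v\<in>V. card {u\<in>V. R i v u}) < (\<Sum>i\<in>{1..k}. 2 * card V)"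
        using \<open>k \<ge> 1\<close> by (intro sum_strict_mono) (auto simp flip: not_le)
      moreover have "(\<Sum>i\<in>{1..k}. card {u\<in>V. R i v u}) = 2 * k" if "v \<in> V" for v
      proof -
        have "(\<Sum>i\<in>{1..k}. card {u\<in>V. R i v u}) = card (\<Union>i\<in>{1..k}. {u\<in>V. R i v u})"
        proof (rule card_UN_disjoint[symmetric]; (intro ballI impI)?)
          fix i j assume ij: "i \<in> {1..k}" "j \<in> {1..k}" "i \<noteq> j"
          then have "X i \<inter> X j = {}" "X i \<subseteq> I" "X j \<subseteq> I"
            using XI by (auto simp: disjoint_family_on_def)
          then have "h ` X i \<inter> h ` X j = {}"
            using inj_on_image_Int[OF h(1), of "X i" "X j"] by simp
          then show "{u\<in>V. R i v u} \<inter> {u\<in>V. R j v u} = {}"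
            by (auto simp: R_def)
        qed (use V in auto)
        also have "(\<Union>i\<in>{1..k}. {u\<in>V. R i v u}) = {u\<in>V. {v, u} \<in> h ` (\<Union>i\<in>{1..k}. X i)}"
          unfolding R_def by blast
        also have "\<dots> = {u. adj v u}"
          unfolding XI h E_iff using V(3) by blast
        finally show ?thesis using deg[OF that] by simp
      qed
      ultimately show False by (simp add: sum.swap[of _ V])
    qed
    then obtain i where i: "i \<in> {1..k}" "2 * card V \<le> (\<Sum>v\<in>V. card {u\<in>V. R i v u})"
      by blast
    have Xi: "X i \<subseteq> I" using i XI by blast
    have R_adj: "adj u v" if "R i u v" for u v
      using that Xi h(2) E_iff unfolding R_def by blast
    have "symp (R i)"
      by (auto simp: R_def insert_commute intro: sympI)
    have "irreflp (R i)"
      using adj(2) R_adj by (meson irreflp_def)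
    obtain W where W: "W \<noteq> {}" "\<And>v. v \<in> W \<Longrightarrow> 2 \<le> card {u\<in>W. R i v u}"
      using min_degree_two_subset[OF V(1,2) \<open>symp (R i)\<close> \<open>irreflp (R i)\<close> i(2)] by blast
    obtain x where x: "\<And>n. R i (x n) (x (Suc n)) \<and> x (Suc (Suc n)) \<noteq> x n"
      using non_backtracking_walk_exists[of W "R i"] W by blast
    have inj_x: "inj_on x {..N}" using x R_adj by (intro girth) blast

    have "\<forall>n. \<exists>j. j \<in> X i \<and> h j = {x n, x (Suc n)}"
      using x unfolding R_def by (metis imageE)
    then obtain g where g: "\<And>n. g n \<in> X i" "\<And>n. h (g n) = {x n, x (Suc n)}" by metis
    \<comment> \<open>Equal numbers mean equal edges, which would make \<open>x m\<close> one of
      \<open>x n\<close> and \<open>x (Suc n)\<close>; \<open>n < N\<close> keeps both indices in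
      the range where \<open>x\<close> is injective.\<close>
    have "g m \<noteq> g n" if "m < n" "n < N" for m n
    proof
      assume "g m = g n"
      then have "x m \<in> {x n, x (Suc n)}" using g(2) by (metis insertI1)
      then show False using that inj_onD[OF inj_x, of m n] inj_onD[OF inj_x, of m "Suc n"] by auto
    qed
    then have inj_g: "inj_on g {..<N}" by (intro linorder_inj_onI) auto

    let ?H = "G \<restriction> X i"
    have "induced_subgraph ?H G"
      using Xi by (intro G.induced_induce) (simp add: G_def)
    then interpret H: sym_digraph ?H by (rule G.induced_graph_imp_graph)
    have reach: "g 0 \<rightarrow>\<^sup>*\<^bsub>?H\<^esub> g n" if "n < N" for n
      using that
    proof (induction n)
      case 0
      then show ?case using g by (intro H.reachable_refl) simp
    next
      case (Suc n)
      have "g n \<noteq> g (Suc n)"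
        using inj_onD[OF inj_g, of n "Suc n"] Suc.prems by auto
      \<comment> \<open>The two distinct edges share the vertex \<open>x (Suc n)\<close>.\<close>
      then have "g n \<rightarrow>\<^bsub>?H\<^esub> g (Suc n)"
        unfolding G_def using g Xi by (intro dominates_induced_intersection_graph) auto
      then show ?case using Suc H.reachable_adj_trans by simp
    qed
    let ?C = "?H \<restriction> {v. g 0 \<rightarrow>\<^sup>*\<^bsub>?H\<^esub> v}"
    have "graph_component ?H ?C"
      using g by (intro H.graph_component_of_reachable) simp
    moreover have "N \<le> card (verts ?C)"
    proof -
      have "{v. g 0 \<rightarrow>\<^sup>*\<^bsub>?H\<^esub> v} \<subseteq> X i"
        by (auto elim: reachable_in_vertsE)
      then have "finite {v. g 0 \<rightarrow>\<^sup>*\<^bsub>?H\<^esub> v}"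
        using Xi h(3) by (meson finite_subset)
      then have "card (g ` {..<N}) \<le> card {v. g 0 \<rightarrow>\<^sup>*\<^bsub>?H\<^esub> v}"
        using reach by (intro card_mono) auto
      then show ?thesis using inj_g by (simp add: card_image)
    qed
    ultimately show ?thesis using i(1) by blast
  qed
  ultimately show ?thesis by blast
qed

end
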